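(* Let $1\le q\le\alpha\le p\le\infty$, $1\le q_1<q_2\le\alpha$ and $\alpha\le p_1<p_2<\infty$, and let $r$ be a positive real number. Then for all $f\in L_0(X)$ $${}_{r}\|f\|_{q_1,p,\alpha}\le\ {}_{r}\|f\|_{q_2,p,\alpha}$$ and $${}_{r}\|f\|_{q,\infty,\alpha}\le C\ {}_{r}\|f\|_{q,p_2,\alpha}\le C'\ {}_{r}\|f\|_{q,p_1,\alpha},$$ where $C>0$ and $C'>0$ are constants independent of $r$ (and of $f$).
   Context: Setting. $(X,d,\mu)$ is a space of homogeneous type: $d$ is a quasi-metric on $X$ (with a constant $\kappa\ge 1$ such that $d(x,y)\le\kappa(d(x,z)+d(z,y))$ for all $x,y,z\in X$), and $\mu$ is a non-negative Borel measure such that, with $B(x,r)=\{y\in X: d(x,y)<r\}$, there is a constant $C$ with $0<\mu(B(x,2r))\le C\mu(B(x,r))<\infty$ for all $x\in X$, $r>0$. It is assumed moreover that all balls $B(x,r)$ are open for the $d$-topology, $(X,d)$ is separable, $\mu(X)=\infty$, and $B(x,R)\setminus B(x,r)\neq\emptyset$ for all $x\in X$ and $0<r<R<\infty$. Notation. $L_0(X)$ is the complex vector space of classes (modulo equality $\mu$-almost everywhere) of $\mu$-measurable complex-valued functions on $X$; $\|\cdot\|_q$ is the usual norm of $L^q(X)=L^q(X,\mu)$; $\chi_E$ is the characteristic function of $E$. For $1\le q\le\alpha\le p\le\infty$, $f\in L_0(X)$ and $r>0$ (convention $1/\infty=0$), $${}_{r}\|f\|_{q,p,\alpha}=\left[\int_X\left(\mu(B(y,r))^{\frac1\alpha-\frac1p-\frac1q}\,\|f\chi_{B(y,r)}\|_q\right)^p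 d\mu(y)\right]^{1/p}\quad\text{if } p<\infty,$$ $${}_{r}\|f\|_{q,\infty,\alpha}=\sup_{y\in X}\mu(B(y,r))^{\frac1\alpha-\frac1q}\,\|f\chi_{B(y,r)}\|_q\quad\text{if } p=\infty.$$ These quantities take values in $[0,\infty]$. *)

theory Defs
  imports "HOL-Probability.Essential_Supremum"
begin

definition quasi_metric_on :: "'a set \<Rightarrow> ('a \<Rightarrow> 'a \<Rightarrow> real) \<Rightarrow> bool" where
  "quasi_metric_on X d \<longleftrightarrow>
     (\<forall>x\<in>X. \<forall>y\<in>X. 0 \<le> d x y \<and> (d x y = 0 \<longleftrightarrow> x = y) \<and> d x y = d y x) \<and>
     (\<exists>\<kappa>\<ge>1. \<forall>x\<in>X. \<forall>y\<in>X. \<forall>z\<in>X. d x y \<le> \<kappa> * (d x z + d z y))"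

definition qball :: "'a set \<Rightarrow> ('a \<Rightarrow> 'a \<Rightarrow> real) \<Rightarrow> 'a \<Rightarrow> real \<Rightarrow> 'a set" where
  "qball X d x r = {y \<in> X. d x y < r}"

text \<open>The balls of a quasi-metric need not be open in this topology in general.\<close>

definition qtopology :: "'a set \<Rightarrow> ('a \<Rightarrow> 'a \<Rightarrow> real) \<Rightarrow> 'a topology" where
  "qtopology X d = topology (\<lambda>U. U \<subseteq> X \<and> (\<forall>x\<in>U. \<exists>r>0. qball X d x r \<subseteq> U))"

lemma openin_qtopology:
  "openin (qtopology X d) U \<longleftrightarrow> U \<subseteq> X \<and> (\<forall>x\<in>U. \<exists>r>0. qball X d x r \<subseteq> U)"
proof -
  have "istopology (\<lambda>U. U \<subseteq> X \<and> (\<forall>x\<in>U. \<exists>r>0. qball X d x r \<subseteq> U))" (is "istopology ?P")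
    unfolding istopology_def
  proof (intro conjI allI impI)
    fix S T assume S: "?P S" and T: "?P T"
    show "S \<inter> T \<subseteq> X" using S by blast
    show "\<forall>x\<in>S \<inter> T. \<exists>r>0. qball X d x r \<subseteq> S \<inter> T"
    proof
      fix x assume "x \<in> S \<inter> T"
      then obtain r s where "r > 0" "qball X d x r \<subseteq> S" "s > 0" "qball X d x s \<subseteq> T"
        using S T by blast
      then have "min r s > 0 \<and> qball X d x (min r s) \<subseteq> S \<inter> T"
        by (auto simp: qball_def)
      then show "\<exists>r>0. qball X d x r \<subseteq> S \<inter> T" by blast
    qed
  next
    fix K assume K: "\<forall>S\<in>K. ?P S"
    show "\<Union>K \<subseteq> X" using K by blast
    show "\<forall>x\<in>\<Union>K. \<exists>r>0. qball X d x r \<subseteq> \<Union>K"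
      using K by (meson Union_iff Union_upper subset_trans)
  qed
  then show ?thesis
    unfolding qtopology_def by (simp add: topology_inverse')
qed

lemma topspace_qtopology [simp]: "topspace (qtopology X d) = X"
proof
  show "topspace (qtopology X d) \<subseteq> X"
    using openin_topspace openin_qtopology by metis
  have "\<exists>r>0. qball X d x r \<subseteq> X" for x
    by (rule exI[of _ 1]) (auto simp: qball_def)
  then have "openin (qtopology X d) X"
    by (simp add: openin_qtopology)
  then show "X \<subseteq> topspace (qtopology X d)" by (rule openin_subset)
qed

locale homogeneous_type_space =
  fixes X :: "'a set" and d :: "'a \<Rightarrow> 'a \<Rightarrow> real" and \<mu> :: "'a measure"
  assumes quasi_metric: "quasi_metric_on X d"
    and sets_eq_borel: "sets \<mu> = sets (sigma X {U. openin (qtopology X d) U})"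
    and doubling: "\<exists>C::real. \<forall>x\<in>X. \<forall>r>0.
        0 < emeasure \<mu> (qball X d x (2 * r)) \<and>
        emeasure \<mu> (qball X d x (2 * r)) \<le> ennreal C * emeasure \<mu> (qball X d x r) \<and>
        ennreal C * emeasure \<mu> (qball X d x r) < \<infinity>"
    and balls_open: "\<forall>x\<in>X. \<forall>r>0. openin (qtopology X d) (qball X d x r)"
    and separable: "separable_space (qtopology X d)"
    and infinite_measure: "emeasure \<mu> X = \<infinity>"
    and annuli_nonempty: "\<forall>x\<in>X. \<forall>r R. 0 < r \<and> r < R \<longrightarrow>
        qball X d x R - qball X d x r \<noteq> {}"

text \<open>Elements of \<open>L\<^sub>0(X)\<close> are given by representatives; \<open>\<mu>\<close>-measurable means
  measurable with respect to the completion of \<open>\<mu>\<close>.  See \<open>amalgam_norm_cong_AE\<close> below for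
  the independence of the representative.\<close>

definition L0 :: "'a measure \<Rightarrow> ('a \<Rightarrow> complex) set" where
  "L0 \<mu> = borel_measurable (completion \<mu>)"

text \<open>Real powers on \<open>[0,\<infinity>]\<close>; only meaningful for exponents \<open>a > 0\<close>.\<close>

definition ennpowr :: "ennreal \<Rightarrow> real \<Rightarrow> ennreal" where
  "ennpowr x a = (if x = \<infinity> then \<infinity> else ennreal (enn2real x powr a))"

definition Lq_norm :: "ennreal \<Rightarrow> 'a measure \<Rightarrow> ('a \<Rightarrow> complex) \<Rightarrow> ennreal" where
  "Lq_norm q M f =
     (if q = \<infinity> then esssup M (\<lambda>x. ennreal (norm (f x)))
      else ennpowr (\<integral>\<^sup>+ x. ennreal (norm (f x) powr enn2real q) \<partial>M) (1 / enn2real q))"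

text \<open>In \<open>ennreal\<close>, \<open>1 / \<infinity> = 0\<close>, so the exponent of the measure of the ball follows the
  convention \<open>1/\<infinity> = 0\<close>.  That measure lies in \<open>(0,\<infinity>)\<close> in a space of homogeneous type,
  so it may be taken as a real number.\<close>

definition amalgam_norm ::
  "'a set \<Rightarrow> ('a \<Rightarrow> 'a \<Rightarrow> real) \<Rightarrow> 'a measure \<Rightarrow>
   real \<Rightarrow> ennreal \<Rightarrow> ennreal \<Rightarrow> ennreal \<Rightarrow> ('a \<Rightarrow> complex) \<Rightarrow> ennreal" where
  "amalgam_norm X d \<mu> r q p \<alpha> f =
     (let F = (\<lambda>y. ennreal (measure \<mu> (qball X d y r)
                      powr (enn2real (1 / \<alpha>) - enn2real (1 / p) - enn2real (1 / q))) *
                    Lq_norm q (completion \<mu>) (\<lambda>x. f x * indicator (qball X d y r) x))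
      in if p = \<infinity> then (SUP y\<in>X. F y)
         else ennpowr (\<integral>\<^sup>+ y. ennpowr (F y) (enn2real p) \<partial>(completion \<mu>)) (1 / enn2real p))"

lemma Lq_norm_cong_AE:
  assumes "f \<in> borel_measurable M" "g \<in> borel_measurable M" "AE x in M. f x = g x"
  shows "Lq_norm q M f = Lq_norm q M g"
proof (cases "q = \<infinity>")
  case True
  have "esssup M (\<lambda>x. ennreal (norm (f x))) = esssup M (\<lambda>x. ennreal (norm (g x)))"
    using assms(3) assms(1,2) by (intro antisym esssup_AE_mono) auto
  with True show ?thesis by (simp add: Lq_norm_def)
next
  case False
  have "(\<integral>\<^sup>+ x. ennreal (norm (f x) powr enn2real q) \<partial>M) =
        (\<integral>\<^sup>+ x. ennreal (norm (g x) powr enn2real q) \<partial>M)"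
    using assms(3) by (intro nn_integral_cong_AE) auto
  with False show ?thesis by (simp add: Lq_norm_def)
qed

lemma (in homogeneous_type_space) qball_sets:
  assumes "y \<in> X" "r > 0" shows "qball X d y r \<in> sets \<mu>"
proof -
  have "{U. openin (qtopology X d) U} \<subseteq> Pow X"
    by (auto simp: openin_qtopology)
  then show ?thesis
    using balls_open assms by (auto simp: sets_eq_borel sets_measure_of intro: sigma_sets.Basic)
qed

lemma (in homogeneous_type_space) amalgam_norm_cong_AE:
  assumes "r > 0" "f \<in> L0 \<mu>" "g \<in> L0 \<mu>" "AE x in completion \<mu>. f x = g x"
  shows "amalgam_norm X d \<mu> r q p \<alpha> f = amalgam_norm X d \<mu> r q p \<alpha> g"
proof -
  have space: "space \<mu> = X"
    using sets_eq_imp_space_eq[OF sets_eq_borel]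
    by (simp add: space_measure_of_conv)
  have eq: "Lq_norm q (completion \<mu>) (\<lambda>x. f x * indicator (qball X d y r) x) =
        Lq_norm q (completion \<mu>) (\<lambda>x. g x * indicator (qball X d y r) x)" if "y \<in> X" for y
  proof (rule Lq_norm_cong_AE)
    have [measurable]: "qball X d y r \<in> sets (completion \<mu>)"
      using qball_sets[OF that \<open>r > 0\<close>] by (rule sets_completionI_sets)
    have [measurable]: "f \<in> borel_measurable (completion \<mu>)" "g \<in> borel_measurable (completion \<mu>)"
      using assms by (auto simp: L0_def)
    show "(\<lambda>x. f x * indicator (qball X d y r) x) \<in> borel_measurable (completion \<mu>)"
         "(\<lambda>x. g x * indicator (qball X d y r) x) \<in> borel_measurable (completion \<mu>)"
      by measurable
    show "AE x in completion \<mu>. f x * indicator (qball X d y r) x = g x * indicator (qball X d y r) x"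
      using assms(4) by eventually_elim simp
  qed
  then show ?thesis
    unfolding amalgam_norm_def Let_def
    by (auto intro!: SUP_cong nn_integral_cong arg_cong2[where f = ennpowr] simp: space)
qed

end

theory Submission
  imports Defs
begin

text \<open>
  Write \<open>m(y)\<close> for the measure of \<open>B(y, r)\<close> and
  \<open>w(y) = m(y)^(1/\<alpha> - 1/q) * \<parallel>f \<chi>_B(y,r)\<parallel>_q\<close>.  The amalgam norm with exponent \<open>p\<close> is the
  \<open>L^p\<close> norm of \<open>w\<close> with respect to \<open>d\<mu>(y) / m(y)\<close>, and its supremum over \<open>X\<close> when \<open>p = \<infinity>\<close>
  (\<open>amalgam_norm_finite\<close>, \<open>amalgam_norm_infinity\<close>).  In this form \<open>q\<close> enters only through \<open>w\<close>
  and \<open>p\<close> only through the outer norm.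

  Monotonicity in \<open>q\<close> already holds for \<open>w\<close> at every point: up to the factor \<open>m(y)^(1/\<alpha>)\<close>,
  \<open>w(y)\<close> is the \<open>L^q\<close> mean of \<open>f\<close> over the ball for the normalized measure, and power means increase
  with the exponent (\<open>normalized_Lq_norm_mono\<close>).

  For the dependence on \<open>p\<close>, the measure \<open>d\<mu>/m\<close> acts on \<open>w\<close> like a measure made of atoms of mass
  bounded below, for which \<open>L^p\<close> norms decrease in \<open>p\<close> up to constants.  The ball \<open>B(y, r)\<close> is
  covered by a bounded number of smaller balls \<open>U\<close>, each with measure comparable to \<open>m(y)\<close> and so small that \<open>U \<subseteq> B(z, r)\<close> for all \<open>z \<in> U\<close> (\<open>comparable_cover\<close>).  Hence
  the contribution of \<open>U\<close> to \<open>w(y)\<close> is at most a constant times \<open>w(z)\<close> for every \<open>z \<in> U\<close>, while \<open>U\<close>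
  has mass bounded below for \<open>d\<mu>/m\<close>.  Integrating over \<open>U\<close> and summing over the cover bounds
  \<open>sup w\<close> by the norm with any finite exponent \<open>p \<ge> \<alpha>\<close> (\<open>local_norm_le_amalgam_norm\<close>).  Writing
  \<open>w^p2 = w^(p2 - p1) * w^p1\<close> and using this bound on the first factor compares two finite exponents
  (\<open>amalgam_norm_antimono_p\<close>).  The constants depend on the
  exponents, on \<open>\<kappa>\<close> and on the doubling constant, and are the same for all \<open>r\<close>.

  Measurability of \<open>w\<close> is avoided: its integrals are only bounded from below by
  those of step functions, compared pointwise, or multiplied by finite constants.
\<close>

section \<open>Powers and integrals with values in the extended half-line\<close>

lemma ennpowr_ennreal [simp]: "0 \<le> x \<Longrightarrow> ennpowr (ennreal x) a = ennreal (x powr a)"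
  by (simp add: ennpowr_def)

lemma ennpowr_top [simp]: "ennpowr top a = top"
  by (simp add: ennpowr_def)

lemma ennpowr_0 [simp]: "ennpowr 0 a = 0"
  by (simp add: ennpowr_def)

lemma ennpowr_mono:
  assumes "x \<le> y" and "0 < a"
  shows "ennpowr x a \<le> ennpowr y a"
  using assms by (cases x; cases y) (auto intro!: powr_mono2 simp: top_unique)

lemma ennpowr_mult:
  assumes "0 < a"
  shows "ennpowr (x * y) a = ennpowr x a * ennpowr y a"
proof (cases x)
  case (real u)
  show ?thesis
  proof (cases y)
    case (real v)
    with \<open>x = ennreal u\<close> \<open>0 \<le> u\<close> show ?thesis
      by (simp add: ennreal_mult[symmetric] powr_mult)
  next
    case top
    with real \<open>0 < a\<close> show ?thesis
      by (cases "u = 0") (auto simp: ennreal_mult_top)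
  qed
next
  case top
  with \<open>0 < a\<close> show ?thesis
    by (cases y) (auto simp: ennreal_top_mult ennpowr_def)
qed

lemma ennpowr_ennpowr: "ennpowr (ennpowr x a) b = ennpowr x (a * b)"
  by (cases x) (auto simp: powr_powr)

lemma ennpowr_one [simp]: "ennpowr x 1 = x"
  by (cases x) auto

lemma ennpowr_add:
  assumes "0 < a" and "0 < b"
  shows "ennpowr x (a + b) = ennpowr x a * ennpowr x b"
  by (cases x) (auto simp: powr_add ennreal_mult)

text \<open>For measurable \<open>f\<close> this is an equality.  The integral is defined as a supremum over simple
  functions below the integrand, and dividing such a function by \<open>c\<close> keeps it simple, so the
  inequality holds for every \<open>f\<close>; it is needed for integrands built from norms over moving balls.\<close>

lemma nn_integral_cmult_le:
  assumes "c < top"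
  shows "(\<integral>\<^sup>+ x. c * f x \<partial>M) \<le> c * (\<integral>\<^sup>+ x. f x \<partial>M)"
proof (cases "c = 0")
  case False
  show ?thesis
    unfolding nn_integral_def[of M "\<lambda>x. c * f x"]
  proof (rule SUP_least, clarify)
    fix g assume g: "simple_function M g" "g \<le> (\<lambda>x. c * f x)"
    have cancel: "c * (g x / c) = g x" for x
      using False assms by (simp add: ennreal_times_divide ennreal_mult_divide_eq mult.commute[of c])
    have "simple_function M (\<lambda>x. g x / c)"
      using g(1) by (rule simple_function_compose1)
    then have meas: "(\<lambda>x. g x / c) \<in> borel_measurable M"
      by (rule borel_measurable_simple_function)
    have "integral\<^sup>S M g = (\<integral>\<^sup>+ x. c * (g x / c) \<partial>M)"
      using nn_integral_eq_simple_integral[OF g(1)] cancel by simp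
    also have "\<dots> = c * (\<integral>\<^sup>+ x. g x / c \<partial>M)"
      using meas by (rule nn_integral_cmult)
    also have "\<dots> \<le> c * (\<integral>\<^sup>+ x. f x \<partial>M)"
    proof (intro mult_left_mono nn_integral_mono)
      fix x
      have "g x / c \<le> c * f x / c"
        using g(2) by (auto simp: le_fun_def intro: divide_right_mono_ennreal)
      also have "\<dots> = f x"
        using False assms by (simp add: ennreal_mult_divide_eq mult.commute[of c])
      finally show "g x / c \<le> f x" .
    qed simp
    finally show "integral\<^sup>S M g \<le> c * (\<integral>\<^sup>+ x. f x \<partial>M)" .
  qed
qed simp

text \<open>The convex function \<open>u^s\<close> lies above its tangent at \<open>u = a\<close>; this is that inequality, solved
  for the linear term.  Since \<open>u\<close> and \<open>u^s\<close> occur linearly, it can be integrated over a set of finite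
  measure, and choosing \<open>a\<close> as the power mean of order \<open>s\<close> then gives Hoelder's inequality.\<close>

lemma powr_tangent_bound:
  fixes a u s :: real
  assumes "0 < a" and "0 \<le> u" and "1 < s"
  shows "u \<le> a powr (1 - s) * u powr s / s + a * (1 - 1 / s)"
proof -
  have "(u / a) * 1 \<le> (u / a) powr s / s + 1 powr (s / (s - 1)) / (s / (s - 1))"
    using assms by (intro Youngs_inequality) (auto simp: field_simps)
  also have "\<dots> = (u / a) powr s / s + (1 - 1 / s)"
    using assms by (simp add: field_simps)
  finally have "a * (u / a) \<le> a * ((u / a) powr s / s + (1 - 1 / s))"
    using assms by (intro mult_left_mono) auto
  also have "\<dots> = a powr (1 - s) * u powr s / s + a * (1 - 1 / s)"
    using assms by (simp add: powr_divide powr_diff algebra_simps)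
  finally show ?thesis
    using assms by simp
qed

text \<open>Power means over a set of finite measure increase with the exponent: the bound
  \<open>powr_tangent_bound\<close> is integrated with \<open>a\<close> equal to the mean on the right, where its two terms
  add up exactly.  If that mean vanishes, so does \<open>g\<close> almost everywhere.\<close>

lemma nn_integral_powr_mean_le:
  fixes g :: "'a \<Rightarrow> real"
  assumes [measurable]: "g \<in> borel_measurable M" "B \<in> sets M"
    and g: "\<And>x. 0 \<le> g x" "\<And>x. x \<notin> B \<Longrightarrow> g x = 0"
    and m: "emeasure M B = ennreal m" "0 < m"
    and ab: "0 < a" "a < b"
  shows "ennpowr (ennreal (1 / m) * (\<integral>\<^sup>+ x. ennreal (g x powr a) \<partial>M)) (1 / a)
       \<le> ennpowr (ennreal (1 / m) * (\<integral>\<^sup>+ x. ennreal (g x powr b) \<partial>M)) (1 / b)"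
proof (cases "\<integral>\<^sup>+ x. ennreal (g x powr b) \<partial>M")
  case top
  then show ?thesis
    using m by (simp add: ennreal_mult_top)
next
  case (real J)
  show ?thesis
  proof (cases "J = 0")
    case True
    with real have "AE x in M. ennreal (g x powr b) = 0"
      by (subst nn_integral_0_iff_AE[symmetric]) auto
    then have "AE x in M. ennreal (g x powr a) = 0"
      by eventually_elim (use g ab in \<open>auto simp: ennreal_eq_0_iff\<close>)
    then have "(\<integral>\<^sup>+ x. ennreal (g x powr a) \<partial>M) = 0"
      by (subst nn_integral_0_iff_AE) auto
    then show ?thesis by simp
  next
    case False
    with real have J: "0 < J" by simp
    (* The integrand is g^a, raised to the power s; t is its power mean of order s. *)
    define s where "s = b / a"
    define t where "t = (J / m) powr (1 / s)"
    have s: "1 < s" and t: "0 < t"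
      using ab J m by (auto simp: s_def t_def)
    have ts: "t powr s = J / m"
      using s J m by (simp add: t_def powr_powr)
    have "(\<integral>\<^sup>+ x. ennreal (g x powr a) \<partial>M)
        \<le> (\<integral>\<^sup>+ x. ennreal (t powr (1 - s) / s) * ennreal (g x powr b)
                 + ennreal (t * (1 - 1 / s)) * indicator B x \<partial>M)"
    proof (rule nn_integral_mono)
      fix x
      show "ennreal (g x powr a) \<le> ennreal (t powr (1 - s) / s) * ennreal (g x powr b)
              + ennreal (t * (1 - 1 / s)) * indicator B x"
      proof (cases "x \<in> B")
        case True
        have "g x powr a \<le> t powr (1 - s) * (g x powr a) powr s / s + t * (1 - 1 / s)"
          using s t by (intro powr_tangent_bound) auto
        also have "(g x powr a) powr s = g x powr b"
          using ab by (simp add: powr_powr s_def)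
        finally show ?thesis
          using True s t by (simp add: ennreal_mult[symmetric] ennreal_plus[symmetric] ennreal_leI del: ennreal_plus)
      qed (use g ab in simp)
    qed
    also have "\<dots> = ennreal (t powr (1 - s) / s) * ennreal J + ennreal (t * (1 - 1 / s)) * ennreal m"
      by (simp add: nn_integral_add nn_integral_cmult nn_integral_cmult_indicator real m)
    also have "\<dots> = ennreal (t powr (1 - s) / s * J + t * (1 - 1 / s) * m)"
      using s t J m by (simp add: ennreal_mult[symmetric] ennreal_plus[symmetric] del: ennreal_plus)
    also have "t powr (1 - s) / s * J + t * (1 - 1 / s) * m = m * t"
    proof -
      have "t powr (1 - s) * J = t * m"
        using ts t J m by (simp add: powr_diff field_simps)
      then show ?thesis
        using s by (simp add: field_simps)
    qed
    finally have "ennreal (1 / m) * (\<integral>\<^sup>+ x. ennreal (g x powr a) \<partial>M) \<le> ennreal (1 / m) * ennreal (m * t)"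
      by (rule mult_left_mono) simp
    also have "\<dots> = ennreal t"
      using m t by (simp add: ennreal_mult[symmetric])
    finally have "ennpowr (ennreal (1 / m) * (\<integral>\<^sup>+ x. ennreal (g x powr a) \<partial>M)) (1 / a)
        \<le> ennpowr (ennreal t) (1 / a)"
      using ab by (intro ennpowr_mono) auto
    also have "\<dots> = ennpowr (ennreal (1 / m) * ennreal J) (1 / b)"
      using ab J m t by (simp add: ennreal_mult[symmetric] t_def powr_powr s_def)
    finally show ?thesis
      using real by simp
  qed
qed

lemma Lq_norm_finite:
  assumes "0 < s"
  shows "Lq_norm (ennreal s) M f = ennpowr (\<integral>\<^sup>+ x. ennreal (norm (f x) powr s) \<partial>M) (1 / s)"
  using assms by (simp add: Lq_norm_def)

lemma enn2real_one_divide: "0 < s \<Longrightarrow> enn2real (1 / ennreal s) = 1 / s"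
  using divide_ennreal[of 1 s] by simp

lemma finite_exponentE:
  assumes "1 \<le> (q::ennreal)" "q < top"
  obtains s where "q = ennreal s" "1 \<le> s"
  using assms by (cases q) auto

text \<open>The exponent of \<open>m\<close> turns the norm into a power mean, and into the plain essential supremum
  for \<open>q = \<infinity>\<close>; the latter bounds every power mean.\<close>

lemma normalized_Lq_norm_mono:
  fixes g :: "'a \<Rightarrow> complex"
  assumes [measurable]: "g \<in> borel_measurable M" "B \<in> sets M"
    and g: "\<And>x. x \<notin> B \<Longrightarrow> g x = 0"
    and m: "emeasure M B = ennreal m" "0 < m"
    and q: "1 \<le> q1" "q1 < q2"
  shows "ennreal (m powr - enn2real (1 / q1)) * Lq_norm q1 M g
       \<le> ennreal (m powr - enn2real (1 / q2)) * Lq_norm q2 M g"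
proof -
  obtain a where a: "q1 = ennreal a" "1 \<le> a"
    using q by (auto elim!: finite_exponentE intro: order.strict_trans2)
  have as_mean: "ennreal (m powr - enn2real (1 / ennreal s)) * Lq_norm (ennreal s) M g
      = ennpowr (ennreal (1 / m) * (\<integral>\<^sup>+ x. ennreal (norm (g x) powr s) \<partial>M)) (1 / s)" if "1 \<le> s" for s
    using that m by (simp add: Lq_norm_finite enn2real_one_divide ennpowr_mult powr_minus_divide powr_divide)
  show ?thesis
  proof (cases "q2 = top")
    case False
    then have "q2 < top" "1 \<le> q2"
      using q by (auto simp: top.not_eq_extremum)
    then obtain b where b: "q2 = ennreal b" "1 \<le> b"
      using finite_exponentE by metis
    with q a have "a < b" by (simp add: ennreal_less_iff)
    with nn_integral_powr_mean_le[of "\<lambda>x. norm (g x)" M B m a b] show ?thesis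
      using a b g m by (simp add: as_mean)
  next
    case True
    define S where "S = esssup M (\<lambda>x. ennreal (norm (g x)))"
    have S: "Lq_norm q2 M g = S"
      by (simp add: True Lq_norm_def S_def)
    have "ennpowr (ennreal (1 / m) * (\<integral>\<^sup>+ x. ennreal (norm (g x) powr a) \<partial>M)) (1 / a) \<le> S"
    proof (cases S)
      case (real u)
      have "AE x in M. ennreal (norm (g x)) \<le> ennreal u"
        using esssup_AE[of "\<lambda>x. ennreal (norm (g x))" M] real by (simp add: S_def)
      then have "(\<integral>\<^sup>+ x. ennreal (norm (g x) powr a) \<partial>M) \<le> (\<integral>\<^sup>+ x. ennreal (u powr a) * indicator B x \<partial>M)"
      proof (intro nn_integral_mono_AE, eventually_elim)
        case (elim x)
        then show ?case
          using a real g[of x] by (cases "x \<in> B") (auto intro!: powr_mono2 ennreal_leI)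
      qed
      also have "\<dots> = ennreal (u powr a * m)"
        using m by (simp add: nn_integral_cmult_indicator ennreal_mult)
      finally have "ennreal (1 / m) * (\<integral>\<^sup>+ x. ennreal (norm (g x) powr a) \<partial>M)
          \<le> ennreal (1 / m) * ennreal (u powr a * m)"
        by (rule mult_left_mono) simp
      also have "\<dots> = ennreal (u powr a)"
        using m by (simp add: ennreal_mult[symmetric])
      finally have "ennpowr (ennreal (1 / m) * (\<integral>\<^sup>+ x. ennreal (norm (g x) powr a) \<partial>M)) (1 / a)
          \<le> ennpowr (ennreal (u powr a)) (1 / a)"
        using a by (intro ennpowr_mono) auto
      then show ?thesis
        using a real by (simp add: powr_powr)
    qed simp
    then show ?thesis
      using a m by (simp only: a as_mean S) (simp add: True)
  qed
qed

section \<open>Balls in a space of homogeneous type\<close>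

context homogeneous_type_space
begin

lemma space_eq: "space \<mu> = X"
  using sets_eq_imp_space_eq[OF sets_eq_borel] by (simp add: space_measure_of_conv)

lemma obtain_qconst:
  obtains \<kappa> where "1 \<le> \<kappa>"
    "\<And>x y z. x \<in> X \<Longrightarrow> y \<in> X \<Longrightarrow> z \<in> X \<Longrightarrow> d x y \<le> \<kappa> * (d x z + d z y)"
  using quasi_metric by (auto simp: quasi_metric_on_def)

lemma dist_sym: "x \<in> X \<Longrightarrow> y \<in> X \<Longrightarrow> d x y = d y x"
  and dist_self: "x \<in> X \<Longrightarrow> d x x = 0"
  using quasi_metric by (auto simp: quasi_metric_on_def)

lemma qball_centre: "x \<in> X \<Longrightarrow> 0 < r \<Longrightarrow> x \<in> qball X d x r"
  by (simp add: qball_def dist_self)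

lemma emeasure_qball:
  assumes "x \<in> X" and "0 < r"
  shows "emeasure \<mu> (qball X d x r) = ennreal (measure \<mu> (qball X d x r))"
    and "0 < measure \<mu> (qball X d x r)"
proof -
  obtain C where C: "0 < emeasure \<mu> (qball X d x (2 * s))"
      "emeasure \<mu> (qball X d x (2 * s)) \<le> ennreal C * emeasure \<mu> (qball X d x s)"
      "ennreal C * emeasure \<mu> (qball X d x s) < \<infinity>" if "0 < s" for s
    using doubling assms(1) by blast
  have pos: "0 < emeasure \<mu> (qball X d x r)"
    using C(1)[of "r / 2"] assms by simp
  have "emeasure \<mu> (qball X d x r) < \<infinity>"
    using C(2,3)[of "r / 2"] assms by (simp add: order.strict_trans1)
  then show eq: "emeasure \<mu> (qball X d x r) = ennreal (measure \<mu> (qball X d x r))"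
    by (intro emeasure_eq_ennreal_measure) auto
  show "0 < measure \<mu> (qball X d x r)"
    using pos by (simp add: eq)
qed

lemma measure_qball_mono:
  assumes "x \<in> X" "0 < r" "y \<in> X" "0 < s" "qball X d x r \<subseteq> qball X d y s"
  shows "measure \<mu> (qball X d x r) \<le> measure \<mu> (qball X d y s)"
proof -
  have "emeasure \<mu> (qball X d x r) \<le> emeasure \<mu> (qball X d y s)"
    using assms by (intro emeasure_mono qball_sets)
  then show ?thesis
    using assms emeasure_qball by simp
qed

lemma measure_qball_dilate:
  obtains D :: real where "1 \<le> D"
    "\<And>x r. x \<in> X \<Longrightarrow> 0 < r \<Longrightarrow> measure \<mu> (qball X d x (t * r)) \<le> D * measure \<mu> (qball X d x r)"
proof -
  obtain C0 where C0: "\<And>x r. x \<in> X \<Longrightarrow> 0 < r \<Longrightarrow>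
      emeasure \<mu> (qball X d x (2 * r)) \<le> ennreal C0 * emeasure \<mu> (qball X d x r)"
    using doubling by blast
  define C where "C = max 1 C0"
  have C: "measure \<mu> (qball X d x (2 * r)) \<le> C * measure \<mu> (qball X d x r)" if "x \<in> X" "0 < r" for x r
  proof -
    have "emeasure \<mu> (qball X d x (2 * r)) \<le> ennreal C * emeasure \<mu> (qball X d x r)"
      using C0[OF that] by (rule order_trans) (auto intro!: mult_right_mono ennreal_leI simp: C_def)
    then show ?thesis
      using that emeasure_qball[of x r] emeasure_qball[of x "2 * r"]
      by (simp add: ennreal_mult[symmetric] C_def)
  qed
  have iter: "measure \<mu> (qball X d x (2 ^ n * r)) \<le> C ^ n * measure \<mu> (qball X d x r)"
    if "x \<in> X" "0 < r" for x r n
  proof (induction n)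
    case (Suc n)
    have "measure \<mu> (qball X d x (2 * (2 ^ n * r))) \<le> C * measure \<mu> (qball X d x (2 ^ n * r))"
      using that by (intro C) auto
    also have "\<dots> \<le> C * (C ^ n * measure \<mu> (qball X d x r))"
      using Suc by (intro mult_left_mono) (auto simp: C_def)
    finally show ?case by (simp add: mult.assoc)
  qed simp
  obtain n where n: "t < 2 ^ n"
    using real_arch_pow[of 2 t] by auto
  have "measure \<mu> (qball X d x (t * r)) \<le> C ^ n * measure \<mu> (qball X d x r)" if "x \<in> X" "0 < r" for x r
  proof (cases "0 < t")
    case True
    have tr: "t * r \<le> 2 ^ n * r" using n that by (intro mult_right_mono) auto
    have "measure \<mu> (qball X d x (t * r)) \<le> measure \<mu> (qball X d x (2 ^ n * r))"
    proof (rule measure_qball_mono)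
      show "qball X d x (t * r) \<subseteq> qball X d x (2 ^ n * r)"
      proof
        fix w assume "w \<in> qball X d x (t * r)"
        then have w: "w \<in> X" "d x w < t * r" by (auto simp: qball_def)
        from w(2) tr have "d x w < 2 ^ n * r" by (rule less_le_trans)
        with w(1) show "w \<in> qball X d x (2 ^ n * r)" by (simp add: qball_def)
      qed
    qed (use that True in auto)
    then show ?thesis using iter[OF that, of n] by linarith
  next
    case False
    have tr: "t * r \<le> 0" using False that by (simp add: mult_nonpos_nonneg)
    have "0 \<le> d x w" if "w \<in> X" for w
      using quasi_metric \<open>x \<in> X\<close> that unfolding quasi_metric_on_def by blast
    then have "qball X d x (t * r) = {}"
      using tr unfolding qball_def by (auto simp: not_less intro: order_trans)
    then show ?thesis by (simp add: C_def)
  qed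
  moreover have "1 \<le> C ^ n" by (simp add: C_def one_le_power)
  ultimately show thesis by (rule that[rotated])
qed

text \<open>A cover of \<open>B(y, r)\<close> suited to transporting information from \<open>B(y, r)\<close> to the balls
  \<open>B(z, r)\<close> of the same radius: a set of the cover lies in \<open>B(z, r)\<close> for each of its points \<open>z\<close>,
  it is not much smaller than \<open>B(y, r)\<close>, and \<open>B(z, r)\<close> is not much larger.\<close>

definition ball_cover :: "real \<Rightarrow> nat \<Rightarrow> 'a \<Rightarrow> real \<Rightarrow> 'a set set \<Rightarrow> bool" where
  "ball_cover D N y r \<U> \<longleftrightarrow>
     finite \<U> \<and> card \<U> \<le> N \<and> \<U> \<subseteq> sets \<mu> \<and> qball X d y r \<subseteq> \<Union>\<U> \<and>
       (\<forall>U\<in>\<U>. ennreal (measure \<mu> (qball X d y r)) \<le> ennreal D * emeasure \<mu> U \<and>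
          (\<forall>z\<in>U. z \<in> X \<and> U \<subseteq> qball X d z r \<and>
             measure \<mu> (qball X d z r) \<le> D * measure \<mu> (qball X d y r)))"

text \<open>The cover consists of the balls of radius \<open>\<delta> = r / (2 \<kappa>)\<close> around a \<open>\<delta>\<close>-separated subset of
  \<open>B(y, r)\<close> of greatest cardinality.  Such a subset has boundedly many points: balls of radius
  \<open>\<delta>' = \<delta> / (2 \<kappa>)\<close> around them are disjoint, lie in \<open>B(y, 2 \<kappa> r)\<close>, and each has measure at
  least a fixed fraction of that of \<open>B(y, r)\<close>.\<close>

lemma comparable_cover:
  obtains D :: real and N :: nat where "1 \<le> D"
    "\<And>y r. y \<in> X \<Longrightarrow> 0 < r \<Longrightarrow> \<exists>\<U>. ball_cover D N y r \<U>"
proof -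
  obtain \<kappa> where \<kappa>: "1 \<le> \<kappa>"
    and tri: "\<And>x y z. x \<in> X \<Longrightarrow> y \<in> X \<Longrightarrow> z \<in> X \<Longrightarrow> d x y \<le> \<kappa> * (d x z + d z y)"
    using obtain_qconst by metis
  have engulf: "qball X d x s \<subseteq> qball X d y u"
    if "x \<in> X" "y \<in> X" "\<kappa> * (d y x + s) \<le> u" for x y s u
  proof
    fix w assume w: "w \<in> qball X d x s"
    then have "d y w \<le> \<kappa> * (d y x + d x w)"
      using that by (intro tri) (auto simp: qball_def)
    also have "\<dots> < \<kappa> * (d y x + s)"
      using w \<kappa> by (simp add: qball_def)
    finally show "w \<in> qball X d y u"
      using w that by (simp add: qball_def)
  qed
  (* The largest dilation that occurs: B(y, r) lies in a ball of radius 2 \<kappa> r = T \<delta>' about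
     each point of B(y, r). *)
  define T where "T = 8 * \<kappa> ^ 3"
  obtain D where D1: "1 \<le> D"
    and D: "\<And>x r. x \<in> X \<Longrightarrow> 0 < r \<Longrightarrow> measure \<mu> (qball X d x (T * r)) \<le> D * measure \<mu> (qball X d x r)"
    using measure_qball_dilate[of T] by blast
  have compare: "measure \<mu> (qball X d x s) \<le> D * measure \<mu> (qball X d y t)"
    if "x \<in> X" "0 < s" "y \<in> X" "0 < t" "\<kappa> * (d y x + s) \<le> T * t" for x s y t
  proof -
    have "0 < T" using \<kappa> by (simp add: T_def)
    have "measure \<mu> (qball X d x s) \<le> measure \<mu> (qball X d y (T * t))"
      using that \<open>0 < T\<close> by (intro measure_qball_mono engulf) auto
    also have "\<dots> \<le> D * measure \<mu> (qball X d y t)"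
      using that by (intro D)
    finally show ?thesis .
  qed
  define N where "N = nat \<lfloor>D * D\<rfloor>"
  have cover: "\<exists>\<U>. ball_cover D N y r \<U>"
    if y: "y \<in> X" and r: "0 < r" for y r
  proof -
    let ?m = "measure \<mu> (qball X d y r)"
    define \<delta> where "\<delta> = r / (2 * \<kappa>)"
    define \<delta>' where "\<delta>' = \<delta> / (2 * \<kappa>)"
    have \<delta>: "0 < \<delta>" "0 < \<delta>'" "r = 2 * \<kappa> * \<delta>" "\<delta> = 2 * \<kappa> * \<delta>'" "\<delta> \<le> r" "\<delta>' \<le> r"
    proof -
      show "0 < \<delta>" "0 < \<delta>'" "r = 2 * \<kappa> * \<delta>" "\<delta> = 2 * \<kappa> * \<delta>'"
        using r \<kappa> by (auto simp: \<delta>_def \<delta>'_def)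
      have "1 * \<delta> \<le> (2 * \<kappa>) * \<delta>" "1 * \<delta>' \<le> (2 * \<kappa>) * \<delta>'"
        using \<kappa> \<open>0 < \<delta>\<close> \<open>0 < \<delta>'\<close> by (intro mult_right_mono; simp)+
      then show "\<delta> \<le> r" "\<delta>' \<le> r"
        using \<open>r = 2 * \<kappa> * \<delta>\<close> \<open>\<delta> = 2 * \<kappa> * \<delta>'\<close> by linarith+
    qed
    have kpow: "1 \<le> \<kappa> ^ 2" "\<kappa> \<le> \<kappa> ^ 2" "\<kappa> ^ 2 \<le> \<kappa> ^ 3"
      using \<kappa> power_increasing[of 1 2 \<kappa>] power_increasing[of 2 3 \<kappa>] by (auto simp: one_le_power)
    define sep where "sep S \<longleftrightarrow> finite S \<and> S \<subseteq> qball X d y r \<and>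
      (\<forall>x\<in>S. \<forall>x'\<in>S. x \<noteq> x' \<longrightarrow> \<delta> \<le> d x x')" for S
    have card_sep: "card S \<le> N" if S: "sep S" for S
    proof -
      have SX: "x \<in> X" "d x y < r" "d y x < r" if "x \<in> S" for x
        using S that y dist_sym[of x y] by (auto simp: sep_def qball_def)
      have disj: "disjoint_family_on (\<lambda>x. qball X d x \<delta>') S"
        unfolding disjoint_family_on_def
      proof (intro ballI impI equals0I)
        fix x x' w assume x: "x \<in> S" "x' \<in> S" "x \<noteq> x'" "w \<in> qball X d x \<delta>' \<inter> qball X d x' \<delta>'"
        then have "d x x' \<le> \<kappa> * (d x w + d w x')"
          using SX by (intro tri) (auto simp: qball_def)
        also have "\<dots> < \<kappa> * (\<delta>' + \<delta>')"
          using x SX dist_sym[of x' w] \<kappa> by (intro mult_strict_left_mono add_strict_mono) (auto simp: qball_def)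
        also have "\<dots> = \<delta>" using \<delta>(4) by simp
        finally have "d x x' < \<delta>" .
        moreover have "\<delta> \<le> d x x'" using x S unfolding sep_def by blast
        ultimately show False by simp
      qed
      have inside: "qball X d x \<delta>' \<subseteq> qball X d y (2 * \<kappa> * r)" if "x \<in> S" for x
      proof (rule engulf)
        have "\<kappa> * (d y x + \<delta>') \<le> \<kappa> * (r + r)"
          using SX[OF that] \<delta> \<kappa> by (intro mult_left_mono add_mono) auto
        then show "\<kappa> * (d y x + \<delta>') \<le> 2 * \<kappa> * r" by simp
      qed (use SX that y in auto)
      have big: "emeasure \<mu> (qball X d y (2 * \<kappa> * r)) = ennreal (measure \<mu> (qball X d y (2 * \<kappa> * r)))"
        "measure \<mu> (qball X d y (2 * \<kappa> * r)) \<le> D * ?m"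
      proof -
        show "emeasure \<mu> (qball X d y (2 * \<kappa> * r)) = ennreal (measure \<mu> (qball X d y (2 * \<kappa> * r)))"
          using y r \<kappa> by (intro emeasure_qball) auto
        have "\<kappa> * (d y y + 2 * \<kappa> * r) = 2 * \<kappa> ^ 2 * r"
          using y by (simp add: dist_self power2_eq_square)
        also have "\<dots> \<le> T * r"
          using kpow r by (intro mult_right_mono) (auto simp: T_def)
        finally show "measure \<mu> (qball X d y (2 * \<kappa> * r)) \<le> D * ?m"
          using y r \<kappa> by (intro compare) auto
      qed
      have small: "?m \<le> D * measure \<mu> (qball X d x \<delta>')" if "x \<in> S" for x
      proof (rule compare)
        have "\<kappa> * (d x y + r) \<le> \<kappa> * (r + r)"
          using SX[OF that] \<kappa> by (intro mult_left_mono add_mono) auto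
        also have "\<dots> = T * \<delta>'"
          by (subst \<delta>(3), subst \<delta>(3), subst \<delta>(4), subst \<delta>(4)) (simp add: T_def power3_eq_cube)
        finally show "\<kappa> * (d x y + r) \<le> T * \<delta>'" .
      qed (use SX that y r \<delta> in auto)
      have "card S * ?m = (\<Sum>x\<in>S. ?m)" by simp
      also have "\<dots> \<le> (\<Sum>x\<in>S. D * measure \<mu> (qball X d x \<delta>'))"
        by (intro sum_mono small)
      also have "\<dots> = D * (\<Sum>x\<in>S. measure \<mu> (qball X d x \<delta>'))"
        by (simp add: sum_distrib_left)
      also have "(\<Sum>x\<in>S. measure \<mu> (qball X d x \<delta>')) = measure \<mu> (\<Union>x\<in>S. qball X d x \<delta>')"
        using S SX disj \<delta> emeasure_qball
        by (intro measure_finite_Union[symmetric]) (auto simp: sep_def intro!: qball_sets)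
      also have "D * measure \<mu> (\<Union>x\<in>S. qball X d x \<delta>') \<le> D * (D * ?m)"
      proof (rule mult_left_mono)
        have "measure \<mu> (\<Union>x\<in>S. qball X d x \<delta>') \<le> measure \<mu> (qball X d y (2 * \<kappa> * r))"
        proof (rule measure_mono_fmeasurable)
          show "(\<Union>x\<in>S. qball X d x \<delta>') \<in> sets \<mu>"
            using S SX \<delta> by (auto simp: sep_def intro!: qball_sets)
          show "qball X d y (2 * \<kappa> * r) \<in> fmeasurable \<mu>"
            using big y r \<kappa> by (intro fmeasurableI qball_sets) auto
        qed (use inside in blast)
        then show "measure \<mu> (\<Union>x\<in>S. qball X d x \<delta>') \<le> D * ?m" using big by linarith
      qed (use D1 in simp)
      finally have "card S * ?m \<le> (D * D) * ?m" by simp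
      then have "card S \<le> D * D"
        using emeasure_qball(2)[OF y r] by simp
      then show ?thesis by (simp add: N_def le_nat_floor)
    qed
    have "sep {}" by (simp add: sep_def)
    then obtain S where S: "sep S" and max: "\<And>S'. sep S' \<Longrightarrow> card S' \<le> card S"
      using ex_has_greatest_nat[of sep "{}" card "Suc N"] card_sep by (auto simp: less_Suc_eq_le)
    have SX: "x \<in> X" "d x y < r" "d y x < r" if "x \<in> S" for x
      using S that y dist_sym[of x y] by (auto simp: sep_def qball_def)
    define \<U> where "\<U> = (\<lambda>x. qball X d x \<delta>) ` S"
    show ?thesis
    unfolding ball_cover_def
    proof (intro exI[of _ \<U>] conjI ballI)
      show "finite \<U>" using S by (simp add: \<U>_def sep_def)
      show "card \<U> \<le> N"
        using S card_image_le[of S "\<lambda>x. qball X d x \<delta>"] card_sep[OF S] by (simp add: \<U>_def sep_def)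
      show "\<U> \<subseteq> sets \<mu>" using SX \<delta> by (auto simp: \<U>_def intro!: qball_sets)
      show "qball X d y r \<subseteq> \<Union>\<U>"
      proof (rule ccontr)
        assume "\<not> ?thesis"
        then obtain w where w: "w \<in> qball X d y r" and far: "\<And>x. x \<in> S \<Longrightarrow> w \<notin> qball X d x \<delta>"
          by (auto simp: \<U>_def)
        have "w \<in> X" using w by (simp add: qball_def)
        have "\<delta> \<le> d x w" "\<delta> \<le> d w x" if "x \<in> S" for x
          using far[OF that] SX(1)[OF that] \<open>w \<in> X\<close> dist_sym[of x w] by (auto simp: qball_def)
        then have "sep (insert w S)"
          using S w by (auto simp: sep_def)
        moreover have "w \<notin> S"
          using far[of w] qball_centre[OF \<open>w \<in> X\<close>, of \<delta>] \<delta> by auto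
        ultimately show False
          using max[of "insert w S"] S by (simp add: sep_def)
      qed
      fix U assume "U \<in> \<U>"
      then obtain x where x: "x \<in> S" "U = qball X d x \<delta>" by (auto simp: \<U>_def)
      have "\<kappa> * (d x y + r) \<le> \<kappa> * (r + r)"
        using SX[OF x(1)] \<kappa> by (intro mult_left_mono add_mono) auto
      also have "\<dots> = 4 * \<kappa> ^ 2 * \<delta>"
        by (subst \<delta>(3), subst \<delta>(3)) (simp add: power2_eq_square)
      also have "\<dots> \<le> T * \<delta>"
        using kpow \<delta> by (intro mult_right_mono) (auto simp: T_def)
      finally have "?m \<le> D * measure \<mu> U"
        using SX x y r \<delta> unfolding x(2) by (intro compare) auto
      then have "ennreal ?m \<le> ennreal (D * measure \<mu> U)" by (rule ennreal_leI)
      then show "ennreal ?m \<le> ennreal D * emeasure \<mu> U"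
        using D1 SX x \<delta> emeasure_qball(1)[of x \<delta>] by (simp add: ennreal_mult)
      fix z assume "z \<in> U"
      then have z: "z \<in> X" "d x z < \<delta>" "d z x < \<delta>"
        using x SX dist_sym[of x z] by (auto simp: qball_def)
      show "z \<in> X" by fact
      show "U \<subseteq> qball X d z r"
        unfolding x(2)
      proof (rule engulf)
        have "\<kappa> * (d z x + \<delta>) \<le> \<kappa> * (\<delta> + \<delta>)"
          using z \<kappa> by (intro mult_left_mono add_mono) auto
        then show "\<kappa> * (d z x + \<delta>) \<le> r" using \<delta>(3) by simp
      qed (use x SX z in auto)
      show "measure \<mu> (qball X d z r) \<le> D * ?m"
      proof (rule compare)
        have "d y z \<le> \<kappa> * (d y x + d x z)" using y z SX x by (intro tri) auto
        also have "\<dots> \<le> \<kappa> * (r + r)"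
          using SX(3)[OF x(1)] z(2) \<delta>(5) \<kappa> by (intro mult_left_mono add_mono; linarith)
        finally have "\<kappa> * (d y z + r) \<le> \<kappa> * (\<kappa> * (r + r) + \<kappa> * r)"
          using \<kappa> r by (intro mult_left_mono add_mono) auto
        also have "\<dots> = 3 * \<kappa> ^ 2 * r" by (simp add: power2_eq_square algebra_simps)
        also have "\<dots> \<le> T * r"
          using kpow r by (intro mult_right_mono) (auto simp: T_def)
        finally show "\<kappa> * (d y z + r) \<le> T * r" .
      qed (use z y r in auto)
    qed
  qed
  show thesis
  proof (rule that)
    show "1 \<le> D" by (rule D1)
  qed (rule cover)
qed

section \<open>The amalgam norm as a weighted norm\<close>

text \<open>The integrand of the amalgam norm without the factor \<open>m(y)^(-1/p)\<close>, which is moved into the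
  measure.\<close>

definition local_norm :: "real \<Rightarrow> ennreal \<Rightarrow> ennreal \<Rightarrow> ('a \<Rightarrow> complex) \<Rightarrow> 'a \<Rightarrow> ennreal" where
  "local_norm r q \<alpha> f y =
     ennreal (measure \<mu> (qball X d y r) powr (enn2real (1 / \<alpha>) - enn2real (1 / q))) *
     Lq_norm q (completion \<mu>) (\<lambda>x. f x * indicator (qball X d y r) x)"

lemma amalgam_norm_infinity: "amalgam_norm X d \<mu> r q \<infinity> \<alpha> f = (SUP y\<in>X. local_norm r q \<alpha> f y)"
  by (simp add: amalgam_norm_def local_norm_def Let_def)

lemma amalgam_norm_finite:
  assumes "0 < r" and "0 < p"
  shows "amalgam_norm X d \<mu> r q (ennreal p) \<alpha> f =
    ennpowr (\<integral>\<^sup>+ y. ennreal (1 / measure \<mu> (qball X d y r)) * ennpowr (local_norm r q \<alpha> f y) p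
      \<partial>completion \<mu>) (1 / p)"
proof -
  have "ennpowr (ennreal (measure \<mu> (qball X d y r) powr
            (enn2real (1 / \<alpha>) - 1 / p - enn2real (1 / q))) * L) p
      = ennreal (1 / measure \<mu> (qball X d y r)) *
        ennpowr (ennreal (measure \<mu> (qball X d y r) powr
            (enn2real (1 / \<alpha>) - enn2real (1 / q))) * L) p" if "y \<in> X" for y L
  proof -
    let ?m = "measure \<mu> (qball X d y r)"
    have "0 < ?m" using emeasure_qball that assms by blast
    have "(enn2real (1 / \<alpha>) - 1 / p - enn2real (1 / q)) * p
        = - 1 + (enn2real (1 / \<alpha>) - enn2real (1 / q)) * p"
      using assms by (simp add: field_simps)
    then have "?m powr ((enn2real (1 / \<alpha>) - 1 / p - enn2real (1 / q)) * p)
        = ?m powr (- 1 + (enn2real (1 / \<alpha>) - enn2real (1 / q)) * p)" by simp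
    also have "\<dots> = (1 / ?m) * ?m powr ((enn2real (1 / \<alpha>) - enn2real (1 / q)) * p)"
      using \<open>0 < ?m\<close> by (simp only: powr_add) (simp add: powr_minus_divide)
    finally have "ennreal (?m powr ((enn2real (1 / \<alpha>) - 1 / p - enn2real (1 / q)) * p))
        = ennreal (1 / ?m) * ennreal (?m powr ((enn2real (1 / \<alpha>) - enn2real (1 / q)) * p))"
      by (simp flip: ennreal_mult)
    then show ?thesis
      using assms by (simp add: ennpowr_mult powr_powr mult.assoc)
  qed
  then show ?thesis
    using assms unfolding amalgam_norm_def local_norm_def Let_def
    by (auto simp: enn2real_one_divide space_eq intro!: arg_cong2[where f = ennpowr] nn_integral_cong)
qed

lemma measurable_cutoff:
  assumes "f \<in> L0 \<mu>" and "U \<in> sets \<mu>"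
  shows "(\<lambda>x. f x * indicator U x) \<in> borel_measurable (completion \<mu>)"
proof -
  have [measurable]: "f \<in> borel_measurable (completion \<mu>)" "U \<in> sets (completion \<mu>)"
    using assms by (auto simp: L0_def)
  show ?thesis by measurable
qed

lemma local_norm_mono_q:
  assumes "y \<in> X" "0 < r" "f \<in> L0 \<mu>" "1 \<le> q1" "q1 < q2"
  shows "local_norm r q1 \<alpha> f y \<le> local_norm r q2 \<alpha> f y"
proof -
  let ?B = "qball X d y r"
  let ?g = "\<lambda>x. f x * indicator ?B x"
  let ?w = "ennreal (measure \<mu> ?B powr enn2real (1 / \<alpha>))"
  have split: "local_norm r q \<alpha> f y =
      ?w * (ennreal (measure \<mu> ?B powr - enn2real (1 / q)) * Lq_norm q (completion \<mu>) ?g)" for q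
  proof -
    have "measure \<mu> ?B powr (enn2real (1 / \<alpha>) - enn2real (1 / q))
        = measure \<mu> ?B powr enn2real (1 / \<alpha>) * measure \<mu> ?B powr - enn2real (1 / q)"
      by (simp flip: powr_add)
    then show ?thesis
      by (simp add: local_norm_def ennreal_mult mult.assoc)
  qed
  have "ennreal (measure \<mu> ?B powr - enn2real (1 / q1)) * Lq_norm q1 (completion \<mu>) ?g
      \<le> ennreal (measure \<mu> ?B powr - enn2real (1 / q2)) * Lq_norm q2 (completion \<mu>) ?g"
    using assms qball_sets[of y r] emeasure_qball[of y r]
    by (intro normalized_Lq_norm_mono[where B = ?B] measurable_cutoff) auto
  then show ?thesis
    unfolding split by (rule mult_left_mono) simp
qed

lemma amalgam_norm_mono_q:
  assumes "0 < r" "f \<in> L0 \<mu>" "1 \<le> q1" "q1 < q2" "1 \<le> p"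
  shows "amalgam_norm X d \<mu> r q1 p \<alpha> f \<le> amalgam_norm X d \<mu> r q2 p \<alpha> f"
proof (cases "p = \<infinity>")
  case True
  then show ?thesis
    using assms by (auto simp only: amalgam_norm_infinity intro!: SUP_subset_mono[OF order_refl] local_norm_mono_q)
next
  case False
  then obtain s where s: "p = ennreal s" "1 \<le> s"
    using assms finite_exponentE[of p] by (metis infinity_ennreal_def top.not_eq_extremum)
  show ?thesis
    unfolding s(1) using assms s
    by (auto simp: amalgam_norm_finite space_eq
        intro!: ennpowr_mono nn_integral_mono mult_left_mono local_norm_mono_q)
qed

section \<open>Dependence on the outer exponent\<close>

lemma local_norm_eq:
  assumes "1 \<le> s" "s \<le> a" "0 < r"
  shows "local_norm r (ennreal s) (ennreal a) f y =
    ennreal (measure \<mu> (qball X d y r) powr (1 / a - 1 / s)) *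
    ennpowr (\<integral>\<^sup>+ x. ennreal (norm (f x) powr s) * indicator (qball X d y r) x \<partial>completion \<mu>) (1 / s)"
proof -
  have "(\<integral>\<^sup>+ x. ennreal (norm (f x * indicator (qball X d y r) x) powr s) \<partial>completion \<mu>)
      = (\<integral>\<^sup>+ x. ennreal (norm (f x) powr s) * indicator (qball X d y r) x \<partial>completion \<mu>)"
    using assms by (intro nn_integral_cong) (simp split: split_indicator)
  then show ?thesis
    using assms by (simp add: local_norm_def Lq_norm_finite enn2real_one_divide)
qed

text \<open>Take a cover as in \<open>comparable_cover\<close>.  The norm of \<open>f\<close> over a set \<open>U\<close> of the cover is at most
  that over \<open>B(z, r)\<close> for all \<open>z \<in> U\<close>, so it is bounded by the mean of order \<open>p\<close> of the
  local norms over \<open>U\<close>.  The exponent \<open>1/\<alpha> - 1/q\<close> of the measure is at most 0, which is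
  why an upper bound on the measure of \<open>B(z, r)\<close> gives a lower bound on the local norm at \<open>z\<close>.\<close>

lemma local_norm_le_amalgam_norm:
  assumes "1 \<le> s" "s \<le> a" "a \<le> p"
  shows "\<exists>C>0. \<forall>r>0. \<forall>f\<in>L0 \<mu>. \<forall>y\<in>X.
      local_norm r (ennreal s) (ennreal a) f y \<le> ennreal C * amalgam_norm X d \<mu> r (ennreal s) (ennreal p) (ennreal a) f"
proof -
  obtain D :: real and N :: nat where D: "1 \<le> D" and cover:
    "\<And>y r. y \<in> X \<Longrightarrow> 0 < r \<Longrightarrow> \<exists>\<U>. ball_cover D N y r \<U>"
    using comparable_cover by metis
  define b where "b = 1 / s - 1 / a"
  have b: "0 \<le> b" using assms by (simp add: b_def frac_le)
  (* One factor D^b replaces the measure of B(z, r) by that of B(y, r) in the local norm; of the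
     two factors D in D * D, one does so in the weight and the other bounds the measure of U below. *)
  define K where "K = D powr b * (D * D) powr (1 / p)"
  have K: "0 < K" using D by (simp add: K_def)
  (* The summand 1 keeps C positive when N = 0. *)
  define C where "C = (real N + 1) powr (1 / s) * K"
  have "0 < C" using K by (simp add: C_def)
  moreover have "local_norm r (ennreal s) (ennreal a) f y
      \<le> ennreal C * amalgam_norm X d \<mu> r (ennreal s) (ennreal p) (ennreal a) f"
    if r: "0 < r" and f: "f \<in> L0 \<mu>" and y: "y \<in> X" for r f y
  proof -
    let ?m = "\<lambda>z. measure \<mu> (qball X d z r)"
    let ?w = "local_norm r (ennreal s) (ennreal a) f"
    let ?A = "amalgam_norm X d \<mu> r (ennreal s) (ennreal p) (ennreal a) f"
    define I where "I U = (\<integral>\<^sup>+ x. ennreal (norm (f x) powr s) * indicator U x \<partial>completion \<mu>)" for U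
    have w: "?w z = ennreal (?m z powr - b) * ennpowr (I (qball X d z r)) (1 / s)" for z
      using assms r by (simp add: local_norm_eq I_def b_def)
    have I_mono: "I U \<le> I V" if "U \<subseteq> V" for U V
      unfolding I_def using that by (intro nn_integral_mono mult_left_mono) (auto split: split_indicator)
    have m: "0 < ?m z" if "z \<in> X" for z using emeasure_qball that r by blast
    obtain \<U> where \<U>_cover: "ball_cover D N y r \<U>"
      using cover[OF y r] by blast
    then have \<U>: "finite \<U>" "card \<U> \<le> N" "\<U> \<subseteq> sets \<mu>" "qball X d y r \<subseteq> \<Union>\<U>"
      and vol: "\<And>U. U \<in> \<U> \<Longrightarrow> ennreal (?m y) \<le> ennreal D * emeasure \<mu> U"
      and near: "\<And>U z. U \<in> \<U> \<Longrightarrow> z \<in> U \<Longrightarrow> z \<in> X \<and> U \<subseteq> qball X d z r \<and> ?m z \<le> D * ?m y"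
      unfolding ball_cover_def by blast+
    have piece: "ennreal (?m y powr - b) * ennpowr (I U) (1 / s) \<le> ennreal K * ?A" if U: "U \<in> \<U>" for U
    proof -
      define v where "v = ennreal (?m y powr - b) * ennpowr (I U) (1 / s)"
      (* Up to a constant, the local norm at each point of U dominates the share v of U in the
         local norm at y. *)
      have lower: "ennreal (D powr - b) * v \<le> ?w z" if "z \<in> U" for z
      proof -
        have z: "z \<in> X" "U \<subseteq> qball X d z r" "?m z \<le> D * ?m y"
          using near[OF U that] by auto
        have "D powr - b * ?m y powr - b = (D * ?m y) powr - b"
          using D by (simp add: powr_mult)
        also have "\<dots> \<le> ?m z powr - b"
          using z m[of z] b by (intro powr_mono2') auto
        finally have "ennreal (D powr - b * ?m y powr - b) * ennpowr (I U) (1 / s) \<le> ?w z"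
          unfolding w using assms z by (intro mult_mono ennreal_leI ennpowr_mono I_mono) auto
        then show ?thesis
          by (simp add: v_def ennreal_mult mult.assoc)
      qed
      have Usets: "U \<in> sets (completion \<mu>)" "emeasure (completion \<mu>) U = emeasure \<mu> U"
        using U \<U>(3) by auto
      let ?c = "ennpowr (ennreal (D powr - b) * v) p"
      have "ennreal (1 / (D * ?m y)) * ?c * emeasure \<mu> U
          = (\<integral>\<^sup>+ z. ennreal (1 / (D * ?m y)) * ?c * indicator U z \<partial>completion \<mu>)"
        using Usets by (simp add: nn_integral_cmult_indicator)
      also have "\<dots> \<le> (\<integral>\<^sup>+ z. ennreal (1 / ?m z) * ennpowr (?w z) p \<partial>completion \<mu>)"
      proof (rule nn_integral_mono)
        fix z
        show "ennreal (1 / (D * ?m y)) * ?c * indicator U z \<le> ennreal (1 / ?m z) * ennpowr (?w z) p"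
        proof (cases "z \<in> U")
          case True
          have "1 / (D * ?m y) \<le> 1 / ?m z"
            using near[OF U True] m[of z] by (intro divide_left_mono) auto
          then show ?thesis
            using True assms lower[OF True] by (auto intro!: mult_mono ennreal_leI ennpowr_mono)
        qed simp
      qed
      finally have int: "ennreal (1 / (D * ?m y)) * ?c * emeasure \<mu> U
          \<le> (\<integral>\<^sup>+ z. ennreal (1 / ?m z) * ennpowr (?w z) p \<partial>completion \<mu>)" .
      have "ennreal (1 / (D * D)) * ?c = ennreal (1 / (D * D * ?m y)) * ?c * ennreal (?m y)"
      proof -
        have "ennreal (1 / (D * D * ?m y)) * ennreal (?m y) = ennreal (1 / (D * D * ?m y) * ?m y)"
          using D m[OF y] by (intro ennreal_mult[symmetric]) auto
        also have "1 / (D * D * ?m y) * ?m y = 1 / (D * D)" using m[OF y] by simp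
        finally have "ennreal (1 / (D * D)) = ennreal (1 / (D * D * ?m y)) * ennreal (?m y)" by (rule sym)
        then show ?thesis by (simp add: mult_ac)
      qed
      also have "\<dots> \<le> ennreal (1 / (D * D * ?m y)) * ?c * (ennreal D * emeasure \<mu> U)"
        using vol[OF U] by (intro mult_left_mono) auto
      also have "\<dots> = ennreal (1 / (D * ?m y)) * ?c * emeasure \<mu> U"
      proof -
        have "ennreal (1 / (D * ?m y)) = ennreal (1 / (D * D * ?m y)) * ennreal D"
          using D m[OF y] by (simp add: ennreal_mult'[symmetric])
        then show ?thesis by (simp add: mult_ac)
      qed
      also note int
      finally have "ennpowr (ennreal (1 / (D * D)) * ?c) (1 / p)
          \<le> ennpowr (\<integral>\<^sup>+ z. ennreal (1 / ?m z) * ennpowr (?w z) p \<partial>completion \<mu>) (1 / p)"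
        using assms by (intro ennpowr_mono) auto
      also have "\<dots> = ?A"
        using assms r by (simp add: amalgam_norm_finite)
      also have "ennpowr (ennreal (1 / (D * D)) * ?c) (1 / p)
          = ennreal ((1 / (D * D)) powr (1 / p)) * (ennreal (D powr - b) * v)"
        using assms by (simp add: ennpowr_mult[of "1 / p"] ennpowr_ennpowr)
      finally have "ennreal K * (ennreal ((1 / (D * D)) powr (1 / p)) * (ennreal (D powr - b) * v)) \<le> ennreal K * ?A"
        by (rule mult_left_mono) simp
      moreover have "ennreal K * (ennreal ((1 / (D * D)) powr (1 / p)) * (ennreal (D powr - b) * v)) = v"
      proof -
        have "K * ((1 / (D * D)) powr (1 / p) * D powr - b) = 1"
          using D by (simp add: K_def powr_divide powr_minus_divide)
        then have "ennreal K * (ennreal ((1 / (D * D)) powr (1 / p)) * ennreal (D powr - b)) = 1"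
          using K by (simp flip: ennreal_mult)
        then show ?thesis by (simp only: mult.assoc[symmetric] mult_1)
      qed
      ultimately show ?thesis by (simp add: v_def)
    qed
    define V where "V = ennreal (?m y powr b) * (ennreal K * ?A)"
    have I_piece: "I U \<le> ennpowr V s" if "U \<in> \<U>" for U
    proof -
      have "?m y powr b * ?m y powr - b = 1" using m[OF y] by (simp flip: powr_add)
      then have "ennreal (?m y powr b) * ennreal (?m y powr - b) = 1" by (simp flip: ennreal_mult)
      then have "ennpowr (I U) (1 / s)
          = ennreal (?m y powr b) * (ennreal (?m y powr - b) * ennpowr (I U) (1 / s))"
        by (simp only: mult.assoc[symmetric] mult_1)
      also have "\<dots> \<le> V"
        unfolding V_def by (intro mult_left_mono piece that) simp
      finally have "ennpowr (ennpowr (I U) (1 / s)) s \<le> ennpowr V s"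
        using assms by (intro ennpowr_mono) auto
      then show ?thesis using assms by (simp add: ennpowr_ennpowr)
    qed
    have "I (qball X d y r) \<le> (\<Sum>U\<in>\<U>. I U)"
    proof -
      have [measurable]: "f \<in> borel_measurable (completion \<mu>)" using f by (simp add: L0_def)
      have [measurable]: "U \<in> sets (completion \<mu>)" if "U \<in> \<U>" for U using that \<U>(3) by auto
      have "I (qball X d y r) \<le> (\<integral>\<^sup>+ x. (\<Sum>U\<in>\<U>. ennreal (norm (f x) powr s) * indicator U x) \<partial>completion \<mu>)"
        unfolding I_def
      proof (rule nn_integral_mono)
        fix x
        show "ennreal (norm (f x) powr s) * indicator (qball X d y r) x
            \<le> (\<Sum>U\<in>\<U>. ennreal (norm (f x) powr s) * indicator U x)"
        proof (cases "x \<in> qball X d y r")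
          case True
          then obtain U where "U \<in> \<U>" "x \<in> U" using \<U>(4) by blast
          then show ?thesis
            using True member_le_sum[of U \<U> "\<lambda>U. ennreal (norm (f x) powr s) * indicator U x"] \<U>(1)
            by simp
        qed simp
      qed
      also have "\<dots> = (\<Sum>U\<in>\<U>. I U)"
        unfolding I_def by (intro nn_integral_sum) measurable
      finally show ?thesis .
    qed
    also have "\<dots> \<le> of_nat (card \<U>) * ennpowr V s"
      using I_piece by (rule sum_bounded_above)
    also have "\<dots> \<le> ennreal (real N + 1) * ennpowr V s"
    proof (rule mult_right_mono)
      have "of_nat (card \<U>) = ennreal (real (card \<U>))" by (simp add: ennreal_of_nat_eq_real_of_nat)
      also have "\<dots> \<le> ennreal (real N + 1)" using \<U>(2) by (intro ennreal_leI) simp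
      finally show "of_nat (card \<U>) \<le> ennreal (real N + 1)" .
    qed simp
    finally have "ennpowr (I (qball X d y r)) (1 / s) \<le> ennpowr (ennreal (real N + 1) * ennpowr V s) (1 / s)"
      using assms by (intro ennpowr_mono) auto
    also have "\<dots> = ennreal ((real N + 1) powr (1 / s)) * V"
      using assms by (simp add: ennpowr_mult ennpowr_ennpowr del: ennreal_plus)
    finally have "?w y \<le> ennreal (?m y powr - b) * (ennreal ((real N + 1) powr (1 / s)) * V)"
      unfolding w by (rule mult_left_mono) simp
    also have "\<dots> = ennreal C * ?A"
    proof -
      have "?m y powr - b * ?m y powr b = 1" using m[OF y] by (simp flip: powr_add)
      then have "ennreal (?m y powr - b) * ennreal (?m y powr b) = 1" by (simp flip: ennreal_mult)
      moreover have "ennreal (?m y powr - b) * (ennreal ((real N + 1) powr (1 / s)) * V)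
          = (ennreal (?m y powr - b) * ennreal (?m y powr b)) *
            (ennreal ((real N + 1) powr (1 / s)) * (ennreal K * ?A))"
        unfolding V_def by (simp only: mult_ac)
      ultimately have "ennreal (?m y powr - b) * (ennreal ((real N + 1) powr (1 / s)) * V)
          = ennreal ((real N + 1) powr (1 / s)) * (ennreal K * ?A)"
        by (simp only: mult_1)
      then show ?thesis using K by (simp add: C_def ennreal_mult mult.assoc)
    qed
    finally show ?thesis .
  qed
  ultimately show ?thesis by blast
qed

text \<open>The inclusion of \<open>L^p1\<close> into \<open>L^p2\<close> for bounded functions, with the bound on the supremum given
  by \<open>local_norm_le_amalgam_norm\<close> for \<open>p1\<close>.\<close>

lemma amalgam_norm_antimono_p:
  assumes "1 \<le> s" "s \<le> a" "a \<le> p1" "p1 < p2"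
  shows "\<exists>C>0. \<forall>r>0. \<forall>f\<in>L0 \<mu>.
      amalgam_norm X d \<mu> r (ennreal s) (ennreal p2) (ennreal a) f
        \<le> ennreal C * amalgam_norm X d \<mu> r (ennreal s) (ennreal p1) (ennreal a) f"
proof -
  obtain C1 where "0 < C1" and C1: "\<And>r f y. 0 < r \<Longrightarrow> f \<in> L0 \<mu> \<Longrightarrow> y \<in> X \<Longrightarrow>
      local_norm r (ennreal s) (ennreal a) f y
        \<le> ennreal C1 * amalgam_norm X d \<mu> r (ennreal s) (ennreal p1) (ennreal a) f"
    using local_norm_le_amalgam_norm[of s a p1] assms by blast
  define C where "C = C1 powr ((p2 - p1) / p2)"
  have "0 < C" using \<open>0 < C1\<close> by (simp add: C_def)
  moreover have "amalgam_norm X d \<mu> r (ennreal s) (ennreal p2) (ennreal a) f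
        \<le> ennreal C * amalgam_norm X d \<mu> r (ennreal s) (ennreal p1) (ennreal a) f"
    if r: "0 < r" and f: "f \<in> L0 \<mu>" for r f
  proof -
    let ?m = "\<lambda>z. measure \<mu> (qball X d z r)"
    let ?w = "local_norm r (ennreal s) (ennreal a) f"
    let ?A = "amalgam_norm X d \<mu> r (ennreal s) (ennreal p1) (ennreal a) f"
    define J where "J p = (\<integral>\<^sup>+ y. ennreal (1 / ?m y) * ennpowr (?w y) p \<partial>completion \<mu>)" for p
    have norm_eq: "amalgam_norm X d \<mu> r (ennreal s) (ennreal p) (ennreal a) f = ennpowr (J p) (1 / p)"
      if "0 < p" for p
      using that r by (simp add: amalgam_norm_finite J_def)
    have J1: "J p1 = ennpowr ?A p1"
      using assms by (simp add: norm_eq ennpowr_ennpowr)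
    show ?thesis
    proof (cases ?A)
      case top
      then show ?thesis using \<open>0 < C\<close> by (simp add: ennreal_mult_top)
    next
      case (real A)
      let ?S = "ennpowr (ennreal C1 * ?A) (p2 - p1)"
      have "J p2 \<le> (\<integral>\<^sup>+ y. ?S * (ennreal (1 / ?m y) * ennpowr (?w y) p1) \<partial>completion \<mu>)"
        unfolding J_def
      proof (rule nn_integral_mono)
        fix y assume "y \<in> space (completion \<mu>)"
        then have y: "y \<in> X" by (simp add: space_eq)
        have "ennpowr (?w y) p2 = ennpowr (?w y) (p2 - p1) * ennpowr (?w y) p1"
          using assms ennpowr_add[of "p2 - p1" p1 "?w y"] by simp
        also have "\<dots> \<le> ?S * ennpowr (?w y) p1"
          using assms C1[OF r f y] by (intro mult_right_mono ennpowr_mono) auto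
        finally have "ennreal (1 / ?m y) * ennpowr (?w y) p2
            \<le> ennreal (1 / ?m y) * (?S * ennpowr (?w y) p1)"
          by (rule mult_left_mono) simp
        then show "ennreal (1 / ?m y) * ennpowr (?w y) p2
            \<le> ?S * (ennreal (1 / ?m y) * ennpowr (?w y) p1)"
          by (simp add: mult.left_commute)
      qed
      also have "\<dots> \<le> ?S * J p1"
        unfolding J_def using real \<open>0 < C1\<close> by (intro nn_integral_cmult_le) (simp flip: ennreal_mult)
      finally have "ennpowr (J p2) (1 / p2) \<le> ennpowr (?S * J p1) (1 / p2)"
        using assms by (intro ennpowr_mono) auto
      also have "\<dots> = ennreal C * ?A"
      proof -
        have "?S * J p1 = ennpowr (ennreal C1) (p2 - p1) * ennpowr ?A p2"
          using assms ennpowr_add[of "p2 - p1" p1 ?A] by (simp add: J1 ennpowr_mult mult.assoc)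
        then show ?thesis
          using assms \<open>0 < C1\<close> by (simp add: ennpowr_mult ennpowr_ennpowr C_def powr_powr)
      qed
      finally show ?thesis using assms by (simp add: norm_eq)
    qed
  qed
  ultimately show ?thesis by blast
qed

end

theorem theorem2p5:
  fixes X :: "'a set" and d :: "'a \<Rightarrow> 'a \<Rightarrow> real" and \<mu> :: "'a measure"
    and q \<alpha> p :: ennreal
  assumes "homogeneous_type_space X d \<mu>"
    and "1 \<le> q" and "q \<le> \<alpha>" and "\<alpha> \<le> p" and "p \<le> \<infinity>"
  shows "(\<forall>q1 q2. 1 \<le> q1 \<and> q1 < q2 \<and> q2 \<le> \<alpha> \<longrightarrow>
            (\<forall>r>0. \<forall>f\<in>L0 \<mu>.
               amalgam_norm X d \<mu> r q1 p \<alpha> f \<le> amalgam_norm X d \<mu> r q2 p \<alpha> f)) \<and>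
         (\<forall>p1 p2. \<alpha> \<le> p1 \<and> p1 < p2 \<and> p2 < \<infinity> \<longrightarrow>
            (\<exists>C>0. \<exists>C'>0. \<forall>r>0. \<forall>f\<in>L0 \<mu>.
               amalgam_norm X d \<mu> r q \<infinity> \<alpha> f \<le> ennreal C * amalgam_norm X d \<mu> r q p2 \<alpha> f \<and>
               ennreal C * amalgam_norm X d \<mu> r q p2 \<alpha> f
                 \<le> ennreal C' * amalgam_norm X d \<mu> r q p1 \<alpha> f))"
proof -
  interpret homogeneous_type_space X d \<mu> by (rule assms(1))
  have in_q: "amalgam_norm X d \<mu> r q1 p \<alpha> f \<le> amalgam_norm X d \<mu> r q2 p \<alpha> f"
    if "1 \<le> q1" "q1 < q2" "0 < r" "f \<in> L0 \<mu>" for q1 q2 r f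
    using that assms by (intro amalgam_norm_mono_q) auto
  have in_p: "\<exists>C>0. \<exists>C'>0. \<forall>r>0. \<forall>f\<in>L0 \<mu>.
      amalgam_norm X d \<mu> r q \<infinity> \<alpha> f \<le> ennreal C * amalgam_norm X d \<mu> r q p2 \<alpha> f \<and>
      ennreal C * amalgam_norm X d \<mu> r q p2 \<alpha> f \<le> ennreal C' * amalgam_norm X d \<mu> r q p1 \<alpha> f"
    if p: "\<alpha> \<le> p1" "p1 < p2" "p2 < \<infinity>" for p1 p2
  proof -
    have fin: "q < top" "\<alpha> < top" "p1 < top" "p2 < top" "1 \<le> \<alpha>" "1 \<le> p1" "1 \<le> p2"
      using assms p by auto
    obtain s where s: "q = ennreal s" "1 \<le> s" using fin assms finite_exponentE by metis
    obtain a where a: "\<alpha> = ennreal a" "1 \<le> a" using fin finite_exponentE by metis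
    obtain u where u: "p1 = ennreal u" "1 \<le> u" using fin finite_exponentE by metis
    obtain v where v: "p2 = ennreal v" "1 \<le> v" using fin finite_exponentE by metis
    have exps: "s \<le> a" "a \<le> u" "u < v"
      using assms p s a u v by (auto simp: ennreal_less_iff)
    obtain C where C: "0 < C" "\<And>r f y. 0 < r \<Longrightarrow> f \<in> L0 \<mu> \<Longrightarrow> y \<in> X \<Longrightarrow>
        local_norm r q \<alpha> f y \<le> ennreal C * amalgam_norm X d \<mu> r q p2 \<alpha> f"
      using local_norm_le_amalgam_norm[of s a v] exps s(2) unfolding s(1) a(1) v(1) by fastforce
    obtain C2 where C2: "0 < C2" "\<And>r f. 0 < r \<Longrightarrow> f \<in> L0 \<mu> \<Longrightarrow>
        amalgam_norm X d \<mu> r q p2 \<alpha> f \<le> ennreal C2 * amalgam_norm X d \<mu> r q p1 \<alpha> f"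
      using amalgam_norm_antimono_p[of s a u v] exps s(2) unfolding s(1) a(1) u(1) v(1) by fastforce
    show ?thesis
    proof (rule exI[of _ C], rule conjI[OF C(1)], rule exI[of _ "C * C2"], intro conjI allI impI ballI)
      fix r :: real and f assume rf: "0 < r" "f \<in> L0 \<mu>"
      show "amalgam_norm X d \<mu> r q \<infinity> \<alpha> f \<le> ennreal C * amalgam_norm X d \<mu> r q p2 \<alpha> f"
        unfolding amalgam_norm_infinity using rf by (intro SUP_least C)
      have "ennreal C * amalgam_norm X d \<mu> r q p2 \<alpha> f
          \<le> ennreal C * (ennreal C2 * amalgam_norm X d \<mu> r q p1 \<alpha> f)"
        using rf by (intro mult_left_mono C2) auto
      then show "ennreal C * amalgam_norm X d \<mu> r q p2 \<alpha> f
          \<le> ennreal (C * C2) * amalgam_norm X d \<mu> r q p1 \<alpha> f"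
        using C C2 by (simp add: ennreal_mult mult.assoc)
    qed (use C C2 in auto)
  qed
  show ?thesis
    using in_q in_p by blast
qed

end
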